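(* Let $A$ be any Noetherian commutative ring, let $R=A[x,y,u,v]$ be the polynomial ring in four variables over $A$, and let $\underline{x}=x_1,x_2,x_3$ where $x_1=xu$, $x_2=yv$, $x_3=xv+yu$. Then $$\mathfrak{h}^3_{\underline{x}}(R)=\underline{\mathfrak{h}}^3_{\underline{x}}(R)=0.$$
   Context: Quasilength: for a finitely generated ideal $I$ of a commutative ring $R$ and an $R$-module $M$, $\mathcal{L}_I(M)$ is the minimum number of factors in a finite filtration of $M$ by submodules all of whose factors are cyclic modules killed by $I$ ($\infty$ if there is no such filtration). Content: let $R$ be a Noetherian ring, $M$ a finitely generated $R$-module, $\underline{x}=x_1,\dots,x_d\in R$, $I=(x_1,\dots,x_d)$. For a $d$-tuple of positive integers $\underline{t}=(t_1,\dots,t_d)$ and $k\ge 0$ write $\underline{t}+k=(t_1+k,\dots,t_d+k)$, $I_{\underline{t}}=(x_1^{t_1},\dots,x_d^{t_d})$, and $$(I_{\underline{t}}M)^{\lim}=\bigcup_{k=0}^\infty\bigl((I_{\underline{t}+k}M):_M(x_1\cdots x_d)^k\bigr).$$ Writing $\underline{t}\ge s$ to mean $t_j\ge s$ for all $j$, define $$\underline{\mathfrak{h}}^d_{\underline{x}}(M)=\lim_{s\to\infty}\inf\Bigl\{\frac{\mathcal{L}_I(M/(I_{\underline{t}}M)^{\lim})}{t_1\cdots t_d}\ :\ \underline{t}\ge s\Bigr\},\qquad \mathfrak{h}^d_{\underline{x}}(M)=\lim_{s\to\infty}\inf\Bigl\{\frac{\mathcal{L}_I(M/I_{\underline{t}}M)}{t_1\cdots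 t_d}\ :\ \underline{t}\ge s\Bigr\}.$$ *)

theory Defs
  imports "HOL-Algebra.UnivPoly" "HOL-Algebra.Ring_Divisibility"
    "HOL-Library.Extended_Nonnegative_Real"
begin

section \<open>Quotient modules and the regular module\<close>

text \<open>The module record extends the ring record, so it has fields \<open>mult\<close> and \<open>one\<close>, which carry no
  information for a module.\<close>

definition quotient_module ::
    "('a, 'm) ring_scheme \<Rightarrow> ('a, 'b, 'n) module_scheme \<Rightarrow> 'b set \<Rightarrow> ('a, 'b set) module" where
  "quotient_module R M N =
    \<lparr>carrier = a_rcosets\<^bsub>M\<^esub> N, mult = (\<lambda>_ _. N), one = N, zero = N, add = set_add M,
     smult = (\<lambda>a C. N <+>\<^bsub>M\<^esub> (\<lambda>m. a \<odot>\<^bsub>M\<^esub> m) ` C)\<rparr>"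

definition regular_module :: "('a, 'm) ring_scheme \<Rightarrow> ('a, 'a) module" where
  "regular_module R =
    \<lparr>carrier = carrier R, mult = mult R, one = \<one>\<^bsub>R\<^esub>, zero = \<zero>\<^bsub>R\<^esub>, add = add R, smult = mult R\<rparr>"

lemma (in cring) regular_module: "module R (regular_module R)"
proof (rule moduleI)
  show "abelian_group (regular_module R)"
    by (rule abelian_groupI)
      (auto simp: regular_module_def a_ac intro: l_neg)
qed (auto simp: regular_module_def l_distr r_distr m_assoc is_cring)

lemma (in module) quotient_module:
  assumes N: "submodule N R M"
  shows "module R (quotient_module R M N)"
proof -
  interpret N: submodule N R M by (rule N)
  have sg: "additive_subgroup N M"
    by (simp add: additive_subgroup.intro N.subgroup_axioms)
  interpret nN: abelian_subgroup N M
    by (rule abelian_subgroupI3[OF sg M.abelian_group_axioms])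
  have NM: "N \<subseteq> carrier M" using submoduleE(1)[OF N] .
  have sm: "N <+>\<^bsub>M\<^esub> (\<lambda>m. a \<odot>\<^bsub>M\<^esub> m) ` (N +>\<^bsub>M\<^esub> x) = N +>\<^bsub>M\<^esub> (a \<odot>\<^bsub>M\<^esub> x)"
    if a: "a \<in> carrier R" and x: "x \<in> carrier M" for a x
  proof (intro equalityI subsetI)
    fix y assume "y \<in> N <+>\<^bsub>M\<^esub> (\<lambda>m. a \<odot>\<^bsub>M\<^esub> m) ` (N +>\<^bsub>M\<^esub> x)"
    then obtain n n' where n: "n \<in> N" "n' \<in> N" and y: "y = n \<oplus>\<^bsub>M\<^esub> a \<odot>\<^bsub>M\<^esub> (n' \<oplus>\<^bsub>M\<^esub> x)"
      by (auto simp: set_add_def' a_r_coset_def')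
    have "y = (n \<oplus>\<^bsub>M\<^esub> a \<odot>\<^bsub>M\<^esub> n') \<oplus>\<^bsub>M\<^esub> a \<odot>\<^bsub>M\<^esub> x"
      using n a x NM by (simp add: y smult_r_distr M.a_assoc subsetD)
    moreover have "n \<oplus>\<^bsub>M\<^esub> a \<odot>\<^bsub>M\<^esub> n' \<in> N"
      using n a nN.a_closed N.smult_closed by auto
    ultimately show "y \<in> N +>\<^bsub>M\<^esub> (a \<odot>\<^bsub>M\<^esub> x)" by (auto simp: a_r_coset_def')
  next
    fix y assume "y \<in> N +>\<^bsub>M\<^esub> (a \<odot>\<^bsub>M\<^esub> x)"
    then obtain n where n: "n \<in> N" and y: "y = n \<oplus>\<^bsub>M\<^esub> a \<odot>\<^bsub>M\<^esub> x" by (auto simp: a_r_coset_def')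
    have "x \<in> N +>\<^bsub>M\<^esub> x" by (rule nN.a_rcos_self[OF x])
    then show "y \<in> N <+>\<^bsub>M\<^esub> (\<lambda>m. a \<odot>\<^bsub>M\<^esub> m) ` (N +>\<^bsub>M\<^esub> x)"
      using n y by (auto simp: set_add_def')
  qed
  have add: "(N +>\<^bsub>M\<^esub> x) <+>\<^bsub>M\<^esub> (N +>\<^bsub>M\<^esub> y) = N +>\<^bsub>M\<^esub> (x \<oplus>\<^bsub>M\<^esub> y)"
    if "x \<in> carrier M" "y \<in> carrier M" for x y
    using that by (rule nN.a_rcos_sum)
  have cl: "N +>\<^bsub>M\<^esub> x \<in> a_rcosets\<^bsub>M\<^esub> N" if "x \<in> carrier M" for x
    using that by (auto simp: A_RCOSETS_def')
  have ag: "abelian_group (quotient_module R M N)"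
  proof (rule abelian_groupI)
    show "\<exists>C'\<in>carrier (quotient_module R M N). C' \<oplus>\<^bsub>quotient_module R M N\<^esub> C = \<zero>\<^bsub>quotient_module R M N\<^esub>"
      if "C \<in> carrier (quotient_module R M N)" for C
    proof -
      from that obtain x where x: "x \<in> carrier M" "C = N +>\<^bsub>M\<^esub> x"
        by (auto simp: quotient_module_def A_RCOSETS_def')
      then have "(N +>\<^bsub>M\<^esub> (\<ominus>\<^bsub>M\<^esub> x)) <+>\<^bsub>M\<^esub> C = N"
        using NM by (simp add: add M.l_neg)
      with x cl[of "\<ominus>\<^bsub>M\<^esub> x"] show ?thesis by (auto simp: quotient_module_def)
    qed
    show "\<zero>\<^bsub>quotient_module R M N\<^esub> \<in> carrier (quotient_module R M N)"
      using cl[of "\<zero>\<^bsub>M\<^esub>"] NM by (simp add: quotient_module_def)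
    show "\<zero>\<^bsub>quotient_module R M N\<^esub> \<oplus>\<^bsub>quotient_module R M N\<^esub> C = C"
      if "C \<in> carrier (quotient_module R M N)" for C
    proof -
      from that obtain x where x: "x \<in> carrier M" "C = N +>\<^bsub>M\<^esub> x"
        by (auto simp: quotient_module_def A_RCOSETS_def')
      then have "(N +>\<^bsub>M\<^esub> \<zero>\<^bsub>M\<^esub>) <+>\<^bsub>M\<^esub> C = C" by (simp add: add del: M.a_coset_add_zero)
      with NM show ?thesis by (simp add: quotient_module_def)
    qed
  qed (auto simp: quotient_module_def A_RCOSETS_def' add M.a_ac)
  show ?thesis
    by (rule moduleI[OF R.is_cring ag])
      (auto simp: quotient_module_def A_RCOSETS_def' sm add smult_l_distr smult_r_distr
        smult_assoc1)
qed

section \<open>Quasilength\<close>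

definition cyclic_module :: "('a, 'm) ring_scheme \<Rightarrow> ('a, 'b, 'n) module_scheme \<Rightarrow> bool" where
  "cyclic_module R M \<longleftrightarrow> (\<exists>g\<in>carrier M. carrier M = {a \<odot>\<^bsub>M\<^esub> g | a. a \<in> carrier R})"

definition killed_by :: "'a set \<Rightarrow> ('a, 'b, 'n) module_scheme \<Rightarrow> bool" where
  "killed_by I M \<longleftrightarrow> (\<forall>a\<in>I. \<forall>m\<in>carrier M. a \<odot>\<^bsub>M\<^esub> m = \<zero>\<^bsub>M\<^esub>)"

definition cyclic_filtration ::
    "('a, 'm) ring_scheme \<Rightarrow> 'a set \<Rightarrow> ('a, 'b, 'n) module_scheme \<Rightarrow> nat \<Rightarrow> (nat \<Rightarrow> 'b set) \<Rightarrow> bool" where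
  "cyclic_filtration R I M n F \<longleftrightarrow>
    F 0 = {\<zero>\<^bsub>M\<^esub>} \<and> F n = carrier M \<and>
    (\<forall>i\<le>n. submodule (F i) R M) \<and>
    (\<forall>i<n. F i \<subseteq> F (Suc i) \<and>
      cyclic_module R (quotient_module R (M\<lparr>carrier := F (Suc i)\<rparr>) (F i)) \<and>
      killed_by I (quotient_module R (M\<lparr>carrier := F (Suc i)\<rparr>) (F i)))"

text \<open>The infimum in \<^typ>\<open>enat\<close> of the empty set is \<open>\<infinity>\<close>; otherwise it is a minimum.\<close>

definition quasilength ::
    "('a, 'm) ring_scheme \<Rightarrow> 'a set \<Rightarrow> ('a, 'b, 'n) module_scheme \<Rightarrow> enat" where
  "quasilength R I M = (INF n\<in>{n. \<exists>F. cyclic_filtration R I M n F}. enat n)"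

section \<open>Content\<close>

text \<open>The sequence \<open>x\<^sub>1, \<dots>, x\<^sub>d\<close> and the exponents \<open>t\<^sub>1, \<dots>, t\<^sub>d\<close> are lists of length \<open>d\<close>.\<close>

definition power_ideal :: "('a, 'm) ring_scheme \<Rightarrow> 'a list \<Rightarrow> nat list \<Rightarrow> 'a set" where
  "power_ideal R xs t = genideal R {(xs ! j) [^]\<^bsub>R\<^esub> (t ! j) | j. j < length xs}"

definition ideal_smult ::
    "('a, 'm) ring_scheme \<Rightarrow> 'a set \<Rightarrow> ('a, 'b, 'n) module_scheme \<Rightarrow> 'b set" where
  "ideal_smult R J M =
    \<Inter>{N. submodule N R M \<and> (\<forall>a\<in>J. \<forall>m\<in>carrier M. a \<odot>\<^bsub>M\<^esub> m \<in> N)}"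

definition submodule_colon :: "('a, 'b, 'n) module_scheme \<Rightarrow> 'b set \<Rightarrow> 'a \<Rightarrow> 'b set" where
  "submodule_colon M N a = {m \<in> carrier M. a \<odot>\<^bsub>M\<^esub> m \<in> N}"

definition limit_closure ::
    "('a, 'm) ring_scheme \<Rightarrow> ('a, 'b, 'n) module_scheme \<Rightarrow> 'a list \<Rightarrow> nat list \<Rightarrow> 'b set" where
  "limit_closure R M xs t =
    (\<Union>k. submodule_colon M (ideal_smult R (power_ideal R xs (map (\<lambda>n. n + k) t)) M)
      ((\<Otimes>\<^bsub>R\<^esub>j\<in>{..<length xs}. xs ! j) [^]\<^bsub>R\<^esub> k))"

definition exponents_ge :: "nat \<Rightarrow> nat \<Rightarrow> nat list set" where
  "exponents_ge d s = {t. length t = d \<and> (\<forall>n\<in>set t. 0 < n \<and> s \<le> n)}"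

text \<open>The infima increase with \<open>s\<close>, so the limits below exist in \<^typ>\<open>ennreal\<close>.\<close>

definition lower_module_content ::
    "('a, 'm) ring_scheme \<Rightarrow> 'a list \<Rightarrow> ('a, 'b, 'n) module_scheme \<Rightarrow> ennreal" where
  "lower_module_content R xs M =
    lim (\<lambda>s. INF t\<in>exponents_ge (length xs) s.
      ennreal_of_enat
        (quasilength R (genideal R (set xs)) (quotient_module R M (limit_closure R M xs t)))
      / of_nat (prod_list t))"

definition module_content ::
    "('a, 'm) ring_scheme \<Rightarrow> 'a list \<Rightarrow> ('a, 'b, 'n) module_scheme \<Rightarrow> ennreal" where
  "module_content R xs M =
    lim (\<lambda>s. INF t\<in>exponents_ge (length xs) s.
      ennreal_of_enat
        (quasilength R (genideal R (set xs))
          (quotient_module R M (ideal_smult R (power_ideal R xs t) M)))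
      / of_nat (prod_list t))"

lemma exponents_ge_INF_LIMSEQ:
  fixes f :: "nat list \<Rightarrow> ennreal"
  shows "(\<lambda>s. INF t\<in>exponents_ge d s. f t) \<longlonglongrightarrow> (SUP s. INF t\<in>exponents_ge d s. f t)"
  by (rule LIMSEQ_SUP) (auto simp: incseq_def exponents_ge_def intro!: INF_superset_mono)

section \<open>Polynomial rings\<close>

text \<open>\<open>A[x, y, u, v]\<close> is built as \<open>A[x][y][u][v]\<close>; a variable is moved up the tower by embedding it
  as a constant polynomial at each later stage.\<close>

abbreviation poly_X :: "('a, 'm) ring_scheme \<Rightarrow> nat \<Rightarrow> 'a" where
  "poly_X S \<equiv> monom (UP S) \<one>\<^bsub>S\<^esub> 1"

abbreviation poly_C :: "('a, 'm) ring_scheme \<Rightarrow> 'a \<Rightarrow> nat \<Rightarrow> 'a" where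
  "poly_C S c \<equiv> monom (UP S) c 0"

definition poly4 where
  "poly4 A = UP (UP (UP (UP A)))"

definition poly4_x where
  "poly4_x A = poly_C (UP (UP (UP A))) (poly_C (UP (UP A)) (poly_C (UP A) (poly_X A)))"

definition poly4_y where
  "poly4_y A = poly_C (UP (UP (UP A))) (poly_C (UP (UP A)) (poly_X (UP A)))"

definition poly4_u where
  "poly4_u A = poly_C (UP (UP (UP A))) (poly_X (UP (UP A)))"

definition poly4_v where
  "poly4_v A = poly_X (UP (UP (UP A)))"

end

theory Submission
  imports Defs
begin

text \<open>Quasilength is subadditive: \<open>L(R/K) \<le> L(R/(K : f)) + L(R/(K + fR))\<close>. Since \<open>I\<close> lies both in \<open>(x, y)\<close>
  and in \<open>(u, v)\<close>, subadditivity gives \<open>L(R/K) \<le> m n\<close> as soon as \<open>K\<close> contains \<open>x\<^sup>m, y\<^sup>n\<close> or \<open>u\<^sup>m, v\<^sup>n\<close>.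
  Let \<open>K\<close> contain the \<open>N\<close>-th powers of \<open>xu\<close>, \<open>yv\<close> and \<open>xv + yu\<close>. Splitting \<open>R/K\<close> at \<open>x\<^sup>N\<close> puts either \<open>u\<^sup>N\<close>
  or \<open>x\<^sup>N\<close> into the ideal. In the first case \<open>(yu)\<^sup>N\<close> and \<open>(xv + yu)\<^sup>N\<close> lie in the ideal, hence so does \<open>(xv)\<^sup>2\<^sup>N\<close>,
  and splitting at \<open>v\<^sup>2\<^sup>N\<close> leaves one ideal containing \<open>x\<^sup>2\<^sup>N, y\<^sup>N\<close> and one containing \<open>u\<^sup>N, v\<^sup>2\<^sup>N\<close>. The second
  case is symmetric. Thus \<open>L(R/K) \<le> 8 N\<^sup>2\<close>, while the exponents \<open>(N, N, N)\<close> are normalised by \<open>N\<^sup>3\<close>; this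
  applies to \<open>I\<^sub>t\<close> and to its limit closure alike.\<close>

section \<open>Chains of ideals with cyclic steps\<close>

context cring
begin

text \<open>An ideal-level record of a filtration of R/K with n cyclic factors killed by I: the
  ideals ascend from K to R, and the factor (K + gR)/K is generated by g and killed by I because Ig
  lies in K. Since g may lie in K, factors may be zero, so n only bounds the quasilength from
  above.\<close>

inductive cyclic_chain :: "'a set \<Rightarrow> 'a set \<Rightarrow> nat \<Rightarrow> bool" for I where
  top: "cyclic_chain I (carrier R) 0"
| step: "\<lbrakk>ideal K R; g \<in> carrier R; \<And>a. a \<in> I \<Longrightarrow> a \<otimes> g \<in> K; cyclic_chain I (K <+>\<^bsub>R\<^esub> PIdl g) n\<rbrakk>
    \<Longrightarrow> cyclic_chain I K (Suc n)"

lemma ideal_add_principal: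
  assumes "ideal K R" "g \<in> carrier R"
  shows "ideal (K <+>\<^bsub>R\<^esub> PIdl g) R" "K \<subseteq> K <+>\<^bsub>R\<^esub> PIdl g" "g \<in> K <+>\<^bsub>R\<^esub> PIdl g"
proof -
  have P: "ideal (PIdl g) R" "g \<in> PIdl g"
    using assms by (auto intro: cgenideal_ideal cgenideal_self)
  show "ideal (K <+>\<^bsub>R\<^esub> PIdl g) R" by (rule add_ideals[OF assms(1) P(1)])
  have "k \<in> K <+>\<^bsub>R\<^esub> PIdl g" if "k \<in> K" for k
  proof -
    have "k = k \<oplus> \<zero>" using ideal.Icarr[OF assms(1) that] by simp
    moreover have "\<zero> \<in> PIdl g" using P(1) by (simp add: additive_subgroup.zero_closed ideal_def)
    ultimately show ?thesis using that unfolding set_add_def' by blast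
  qed
  then show "K \<subseteq> K <+>\<^bsub>R\<^esub> PIdl g" by blast
  have "g = \<zero> \<oplus> g" using assms by simp
  moreover have "\<zero> \<in> K" using assms(1) by (simp add: additive_subgroup.zero_closed ideal_def)
  ultimately show "g \<in> K <+>\<^bsub>R\<^esub> PIdl g" using P(2) unfolding set_add_def' by blast
qed

lemma add_principal_minimal:
  assumes "ideal L R" "K \<subseteq> L" "g \<in> L"
  shows "K <+>\<^bsub>R\<^esub> PIdl g \<subseteq> L"
proof -
  have "PIdl g \<subseteq> L" using assms by (intro cgenideal_minimal)
  then show ?thesis
    using assms(2) additive_subgroup.a_closed[OF ideal.axioms(1)[OF assms(1)]]
    unfolding set_add_def' by blast
qed

lemma add_principal_absorb:
  assumes "ideal K R" "g \<in> K"
  shows "K <+>\<^bsub>R\<^esub> PIdl g = K"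
  using add_principal_minimal[OF assms(1) subset_refl assms(2)]
    ideal_add_principal(2)[OF assms(1) ideal.Icarr[OF assms]] by blast

lemma ideal_colon:
  assumes K: "ideal K R" and f: "f \<in> carrier R"
  shows "ideal {r \<in> carrier R. r \<otimes> f \<in> K} R"
proof (rule idealI[OF ring_axioms])
  interpret K: ideal K R by (rule K)
  show "subgroup {r \<in> carrier R. r \<otimes> f \<in> K} (add_monoid R)"
  proof (rule add.subgroupI)
    show "{r \<in> carrier R. r \<otimes> f \<in> K} \<noteq> {}" using f by (auto intro!: exI[of _ \<zero>])
  qed (use f K.a_closed K.a_inv_closed in \<open>auto simp: l_distr l_minus\<close>)
  fix a b assume "a \<in> {r \<in> carrier R. r \<otimes> f \<in> K}" and b: "b \<in> carrier R"
  then have a: "a \<in> carrier R" "a \<otimes> f \<in> K" by auto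
  have "b \<otimes> a \<otimes> f \<in> K" using K.I_l_closed[OF a(2) b] a b f by (simp add: m_assoc)
  then show "b \<otimes> a \<in> {r \<in> carrier R. r \<otimes> f \<in> K}" "a \<otimes> b \<in> {r \<in> carrier R. r \<otimes> f \<in> K}"
    using a b by (auto simp: m_comm)
qed

text \<open>A chain for \<open>R/L\<close> is pushed through the surjection from \<open>R/L\<close> onto \<open>(K + fR)/K\<close> given by multiplication by \<open>f\<close>.\<close>

lemma cyclic_chain_colon:
  assumes "cyclic_chain I L m" "I \<subseteq> carrier R"
    and "ideal K R" "f \<in> carrier R" "\<And>r. r \<in> L \<Longrightarrow> r \<otimes> f \<in> K"
    and "cyclic_chain I (K <+>\<^bsub>R\<^esub> PIdl f) n"
  shows "cyclic_chain I K (m + n)"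
  using assms
proof (induction arbitrary: K rule: cyclic_chain.induct)
  case top
  \<comment> \<open>Here L = R, so f itself lies in K and K + fR = K.\<close>
  then have "\<one> \<otimes> f \<in> K" by blast
  with top show ?case by (simp add: add_principal_absorb)
next
  case (step L g m)
  let ?K' = "K <+>\<^bsub>R\<^esub> PIdl (g \<otimes> f)"
  have gf: "g \<otimes> f \<in> carrier R" using step.hyps step.prems by simp
  note K' = ideal_add_principal[OF step.prems(2) gf]
  \<comment> \<open>The step from L to L + gR is mirrored by the step from K to K + gfR; the colon
    ideal of f in the latter contains both L and g.\<close>
  have colon: "r \<otimes> f \<in> ?K'" if "r \<in> L <+>\<^bsub>R\<^esub> PIdl g" for r
  proof -
    have "L <+>\<^bsub>R\<^esub> PIdl g \<subseteq> {r \<in> carrier R. r \<otimes> f \<in> ?K'}"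
      using step.hyps step.prems K' by (intro add_principal_minimal ideal_colon)
        (auto dest: ideal.Icarr)
    with that show ?thesis by blast
  qed
  have f: "f \<in> carrier R" by fact
  have "ideal (K <+>\<^bsub>R\<^esub> PIdl f) R" "K \<subseteq> K <+>\<^bsub>R\<^esub> PIdl f" "f \<in> K <+>\<^bsub>R\<^esub> PIdl f"
    by (rule ideal_add_principal[OF step.prems(2) f])+
  moreover have "ideal (?K' <+>\<^bsub>R\<^esub> PIdl f) R" "?K' \<subseteq> ?K' <+>\<^bsub>R\<^esub> PIdl f" "f \<in> ?K' <+>\<^bsub>R\<^esub> PIdl f"
    by (rule ideal_add_principal[OF K'(1) f])+
  \<comment> \<open>As gf is a multiple of f, the chain already given above K + fR also serves for
    the enlarged ideal.\<close>
  ultimately have "?K' <+>\<^bsub>R\<^esub> PIdl f = K <+>\<^bsub>R\<^esub> PIdl f"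
    using step.hyps K'
    by (intro equalityI add_principal_minimal) (auto intro: ideal.I_l_closed)
  then have "cyclic_chain I ?K' (m + n)"
    using step K' colon by simp
  moreover have "a \<otimes> (g \<otimes> f) \<in> K" if "a \<in> I" for a
  proof -
    have "a \<in> carrier R" using that step.prems by blast
    moreover have "a \<otimes> g \<otimes> f \<in> K" using that step by blast
    ultimately show ?thesis using step by (simp add: m_assoc)
  qed
  ultimately have "cyclic_chain I K (Suc (m + n))"
    using step.prems gf by (intro cyclic_chain.step) auto
  then show ?case by simp
qed

text \<open>Multiplication by f gives the exact sequence 0 -> R/(K : f) -> R/K -> R/(K + fR) -> 0;
  this is the case L = (K : f) of \<open>cyclic_chain_colon\<close>.\<close>

lemma cyclic_chain_split:
  assumes "I \<subseteq> carrier R" "ideal K R" "f \<in> carrier R"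
    and "cyclic_chain I {r \<in> carrier R. r \<otimes> f \<in> K} m" "cyclic_chain I (K <+>\<^bsub>R\<^esub> PIdl f) n"
  shows "cyclic_chain I K (m + n)"
  using cyclic_chain_colon[OF assms(4,1,2,3) _ assms(5)] by simp

text \<open>Nested inductions by splitting: passing to (K : a) lowers the exponent of a by one, and
  K + aR contains a, leaving a row of n factors in the powers of b. The m n factors correspond to
  the monomials a^i b^j with i < m and j < n.\<close>

lemma cyclic_chain_two_powers:
  assumes I: "I \<subseteq> carrier R" and a: "a \<in> carrier R" and b: "b \<in> carrier R"
    and sub: "\<And>K. ideal K R \<Longrightarrow> a \<in> K \<Longrightarrow> b \<in> K \<Longrightarrow> I \<subseteq> K"
    and K: "ideal K R" "a [^] m \<in> K" "b [^] n \<in> K"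
  shows "cyclic_chain I K (m * n)"
proof -
  have full: "cyclic_chain I K 0" if "ideal K R" "\<one> \<in> K" for K
    using that ideal.one_imp_carrier cyclic_chain.top by metis
  have row: "cyclic_chain I K n" if "ideal K R" "a \<in> K" "b [^] n \<in> K" for K n
    using that
  proof (induction n arbitrary: K)
    case 0
    then show ?case using full by simp
  next
    case (Suc n)
    let ?C = "{r \<in> carrier R. r \<otimes> b \<in> K}" and ?S = "K <+>\<^bsub>R\<^esub> PIdl b"
    note S = ideal_add_principal[OF Suc.prems(1) b]
    \<comment> \<open>This ideal contains both a and b, hence I, so its quotient ring, generated by
      1, is a single admissible factor.\<close>
    have "I \<subseteq> ?S" using S Suc.prems by (intro sub) auto
    then have "x \<otimes> \<one> \<in> ?S" if "x \<in> I" for x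
      using that I by (metis r_one subsetD)
    moreover have "cyclic_chain I (?S <+>\<^bsub>R\<^esub> PIdl \<one>) 0"
      using full ideal_add_principal[OF S(1) one_closed] by blast
    ultimately have "cyclic_chain I ?S 1"
      using cyclic_chain.step[OF S(1) one_closed] by simp
    moreover have "cyclic_chain I ?C n"
      using Suc.prems a b by (intro Suc.IH ideal_colon) (auto intro: ideal.I_r_closed)
    ultimately show ?case using cyclic_chain_split[OF I Suc.prems(1) b] by fastforce
  qed
  show ?thesis using K
  proof (induction m arbitrary: K)
    case 0
    then show ?case using full by simp
  next
    case (Suc m)
    let ?C = "{r \<in> carrier R. r \<otimes> a \<in> K}" and ?S = "K <+>\<^bsub>R\<^esub> PIdl a"
    note S = ideal_add_principal[OF Suc.prems(1) a]
    have "cyclic_chain I ?S n" using S Suc.prems by (intro row) auto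
    moreover have "cyclic_chain I ?C (m * n)"
      using Suc.prems a b by (intro Suc.IH ideal_colon) (auto intro: ideal.I_r_closed)
    ultimately have "cyclic_chain I K (m * n + n)"
      using cyclic_chain_split[OF I Suc.prems(1) a] by blast
    then show ?case by (simp add: add.commute)
  qed
qed

text \<open>Writing p = (p + q) - q replaces a binomial expansion: c p^(l+1) = c(p + q) p^l - c q
  p^l. The coefficient c makes the induction work, since it absorbs one factor p + q or q and so
  lowers m or n by one.\<close>

lemma ideal_power_of_sum:
  fixes m n :: nat
  assumes K: "ideal K R" and carr: "p \<in> carrier R" "q \<in> carrier R" "c \<in> carrier R"
    and "c \<otimes> (p \<oplus> q) [^] m \<in> K" "c \<otimes> q [^] n \<in> K"
  shows "c \<otimes> p [^] (m + n) \<in> K"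
proof -
  interpret K: ideal K R by (rule K)
  show ?thesis using assms(4-)
  proof (induction "m + n" arbitrary: c m n)
    case 0
    then show ?case by simp
  next
    case (Suc l)
    show ?case
    proof (cases "m = 0 \<or> n = 0")
      case True
      \<comment> \<open>A zero exponent turns one of the two hypotheses into c \<in> K.\<close>
      then have "c \<in> K" using Suc.prems by auto
      then show ?thesis using carr K.I_r_closed by simp
    next
      case False
      then obtain m' n' where mn: "m = Suc m'" "n = Suc n'"
        by (metis not0_implies_Suc)
      have "c \<otimes> (p \<oplus> q) \<otimes> (p \<oplus> q) [^] m' \<in> K" "c \<otimes> q \<otimes> q [^] n' \<in> K"
        using Suc.prems carr mn by (simp_all add: m_ac)
      moreover have "c \<otimes> (p \<oplus> q) \<otimes> q [^] n = c \<otimes> q [^] n \<otimes> (p \<oplus> q)"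
          "c \<otimes> q \<otimes> (p \<oplus> q) [^] m = c \<otimes> (p \<oplus> q) [^] m \<otimes> q"
        using Suc.prems carr by (simp_all add: m_ac)
      then have "c \<otimes> (p \<oplus> q) \<otimes> q [^] n \<in> K" "c \<otimes> q \<otimes> (p \<oplus> q) [^] m \<in> K"
        using Suc.prems carr K.I_r_closed by simp_all
      ultimately have "c \<otimes> (p \<oplus> q) \<otimes> p [^] (m' + n) \<in> K" "c \<otimes> q \<otimes> p [^] (m + n') \<in> K"
        using Suc.hyps(1)[of m' n "c \<otimes> (p \<oplus> q)"] Suc.hyps(1)[of m n' "c \<otimes> q"]
          Suc.hyps(2) Suc.prems carr mn by auto
      moreover have "m' + n = l" "m + n' = l" "m + n = Suc l" using mn Suc.hyps(2) by auto
      ultimately have "c \<otimes> (p \<oplus> q) \<otimes> p [^] l \<oplus> (\<ominus> (c \<otimes> q \<otimes> p [^] l)) \<in> K"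
        using K.a_closed K.a_inv_closed by simp
      moreover have "c \<otimes> (p \<oplus> q) \<otimes> p [^] l \<oplus> (\<ominus> (c \<otimes> q \<otimes> p [^] l)) = c \<otimes> p [^] Suc l"
      proof -
        have "c \<otimes> (p \<oplus> q) \<otimes> p [^] l = c \<otimes> p [^] Suc l \<oplus> c \<otimes> q \<otimes> p [^] l"
          using carr Suc.prems by (simp add: r_distr l_distr m_ac)
        then show ?thesis using carr Suc.prems by (simp add: a_assoc r_neg)
      qed
      ultimately show ?thesis using \<open>m + n = Suc l\<close> by simp
    qed
  qed
qed

text \<open>The two splittings end in four ideals, each containing the N-th power of one element and
  the 2N-th power of the other from the pair x, y or the pair u, v. Each contributes 2 N^2 factors,
  which gives 8 N^2.\<close>

lemma cyclic_chain_segre: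
  fixes N :: nat
  assumes carr: "x \<in> carrier R" "y \<in> carrier R" "u \<in> carrier R" "v \<in> carrier R"
    and K: "ideal K R" "(x \<otimes> u) [^] N \<in> K" "(y \<otimes> v) [^] N \<in> K"
      "(x \<otimes> v \<oplus> y \<otimes> u) [^] N \<in> K"
  shows "cyclic_chain (Idl {x \<otimes> u, y \<otimes> v, x \<otimes> v \<oplus> y \<otimes> u}) K (8 * N\<^sup>2)"
proof -
  define I where "I = Idl {x \<otimes> u, y \<otimes> v, x \<otimes> v \<oplus> y \<otimes> u}"
  have I: "I \<subseteq> carrier R"
    unfolding I_def using carr
    by (intro additive_subgroup.a_subset[OF ideal.axioms(1)[OF genideal_ideal]]) auto
  have subI: "I \<subseteq> L" if "ideal L R" "x \<otimes> u \<in> L" "y \<otimes> v \<in> L" "x \<otimes> v \<in> L" "y \<otimes> u \<in> L" for L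
    unfolding I_def using that additive_subgroup.a_closed[OF ideal.axioms(1)[OF that(1)]]
    by (intro genideal_minimal) auto
  have xy: "I \<subseteq> L" if "ideal L R" "x \<in> L" "y \<in> L" for L
    using that carr by (intro subI) (auto intro: ideal.I_r_closed)
  have uv: "I \<subseteq> L" if "ideal L R" "u \<in> L" "v \<in> L" for L
    using that carr by (intro subI) (auto intro: ideal.I_l_closed)
  have powxv: "(x \<otimes> v) [^] (N + N) \<in> L"
    if L: "ideal L R" "(x \<otimes> v \<oplus> y \<otimes> u) [^] N \<in> L" "(y \<otimes> u) [^] N \<in> L" for L
    using ideal_power_of_sum[OF L(1), of "x \<otimes> v" "y \<otimes> u" \<one> N N] L carr by simp
  have powyu: "(y \<otimes> u) [^] (N + N) \<in> L"
    if L: "ideal L R" "(x \<otimes> v \<oplus> y \<otimes> u) [^] N \<in> L" "(x \<otimes> v) [^] N \<in> L" for L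
    using ideal_power_of_sum[OF L(1), of "y \<otimes> u" "x \<otimes> v" \<one> N N] L carr by (simp add: a_comm)
  define C where "C = {r \<in> carrier R. r \<otimes> x [^] N \<in> K}"
  have xN: "x [^] N \<in> carrier R" using carr by simp
  have C: "ideal C R" unfolding C_def by (rule ideal_colon[OF K(1) xN])
  have KC: "r \<in> C" if "r \<in> K" for r
    using that K(1) xN by (auto simp: C_def intro: ideal.I_r_closed ideal.Icarr)
  \<comment> \<open>This is (xu)^N \<in> K read in the colon ideal of x^N.\<close>
  have uC: "u [^] N \<in> C" using K(2) carr by (auto simp: C_def pow_mult_distrib m_comm)
  have chainC: "cyclic_chain I C (4 * N\<^sup>2)"
  proof -
    let ?f = "v [^] (N + N)"
    have f: "?f \<in> carrier R" using carr by simp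
    have "y [^] N \<otimes> ?f \<in> C"
    proof -
      have "y [^] N \<otimes> ?f = (y \<otimes> v) [^] N \<otimes> v [^] N"
        using carr by (simp add: nat_pow_mult[symmetric] pow_mult_distrib m_ac)
      then show ?thesis using KC[OF K(3)] C carr by (simp add: ideal.I_r_closed)
    qed
    \<comment> \<open>The element is (xv)^(2N): modulo \<open>C\<close> the N-th powers of yu and of
      xv + yu vanish, the former because u^N does.\<close>
    moreover have "x [^] (N + N) \<otimes> ?f \<in> C"
    proof -
      have "(y \<otimes> u) [^] N \<in> C"
        using uC C carr by (simp add: pow_mult_distrib[OF m_comm] ideal.I_l_closed)
      then show ?thesis
        using powxv[OF C KC[OF K(4)]] carr by (simp add: pow_mult_distrib[OF m_comm])
    qed
    ultimately have "cyclic_chain I {r \<in> carrier R. r \<otimes> ?f \<in> C} ((N + N) * N)"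
      using carr by (intro cyclic_chain_two_powers[OF I carr(1,2) xy] ideal_colon C) auto
    moreover have "cyclic_chain I (C <+>\<^bsub>R\<^esub> PIdl ?f) (N * (N + N))"
      using carr uC ideal_add_principal[OF C f]
      by (intro cyclic_chain_two_powers[OF I carr(3,4) uv]) auto
    ultimately have "cyclic_chain I C ((N + N) * N + N * (N + N))"
      by (rule cyclic_chain_split[OF I C f])
    moreover have "(N + N) * N + N * (N + N) = 4 * N\<^sup>2"
      by (simp add: power2_eq_square distrib_left distrib_right)
    ultimately show ?thesis by simp
  qed
  \<comment> \<open>The other half of the splitting at x^N: exchanging x with u and y with v turns
    the argument for \<open>C\<close> into the one for \<open>S\<close>.\<close>
  define S where "S = K <+>\<^bsub>R\<^esub> PIdl (x [^] N)"
  have S: "ideal S R" "K \<subseteq> S" "x [^] N \<in> S"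
    unfolding S_def by (rule ideal_add_principal[OF K(1) xN])+
  have "cyclic_chain I S (4 * N\<^sup>2)"
  proof -
    let ?f = "y [^] (N + N)"
    have f: "?f \<in> carrier R" using carr by simp
    have "v [^] N \<otimes> ?f \<in> S"
    proof -
      have "v [^] N \<otimes> ?f = (y \<otimes> v) [^] N \<otimes> y [^] N"
        using carr by (simp add: nat_pow_mult[symmetric] pow_mult_distrib m_ac)
      then show ?thesis using K(3) S carr by (auto intro: ideal.I_r_closed)
    qed
    moreover have "u [^] (N + N) \<otimes> ?f \<in> S"
      using powyu[OF S(1) subsetD[OF S(2) K(4)]] S carr
      by (simp add: pow_mult_distrib m_comm ideal.I_l_closed)
    ultimately have "cyclic_chain I {r \<in> carrier R. r \<otimes> ?f \<in> S} ((N + N) * N)"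
      using carr by (intro cyclic_chain_two_powers[OF I carr(3,4) uv] ideal_colon S) auto
    moreover have "cyclic_chain I (S <+>\<^bsub>R\<^esub> PIdl ?f) (N * (N + N))"
      using carr S ideal_add_principal[OF S(1) f]
      by (intro cyclic_chain_two_powers[OF I carr(1,2) xy]) auto
    ultimately have "cyclic_chain I S ((N + N) * N + N * (N + N))"
      by (rule cyclic_chain_split[OF I S(1) f])
    moreover have "(N + N) * N + N * (N + N) = 4 * N\<^sup>2"
      by (simp add: power2_eq_square distrib_left distrib_right)
    ultimately show ?thesis by simp
  qed
  with chainC have "cyclic_chain I K (4 * N\<^sup>2 + 4 * N\<^sup>2)"
    unfolding C_def S_def by (rule cyclic_chain_split[OF I K(1) xN])
  then show ?thesis by (simp add: I_def)
qed

text \<open>Unfolds the inductive chain into the indexed family of ideals that a filtration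
  requires; each step puts its ideal in front and shifts the rest.\<close>

lemma cyclic_chain_filtration:
  assumes "cyclic_chain I K n" "ideal K R"
  obtains F where "F 0 = K" "F n = carrier R" "\<And>i. i \<le> n \<Longrightarrow> ideal (F i) R"
    "\<And>i. i < n \<Longrightarrow>
      \<exists>g\<in>carrier R. F (Suc i) = F i <+>\<^bsub>R\<^esub> PIdl g \<and> (\<forall>a\<in>I. a \<otimes> g \<in> F i)"
proof -
  have "\<exists>F. F 0 = K \<and> F n = carrier R \<and> (\<forall>i\<le>n. ideal (F i) R) \<and>
      (\<forall>i<n. \<exists>g\<in>carrier R. F (Suc i) = F i <+>\<^bsub>R\<^esub> PIdl g \<and> (\<forall>a\<in>I. a \<otimes> g \<in> F i))"
    using assms
  proof (induction rule: cyclic_chain.induct)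
    case top
    then show ?case by (intro exI[of _ "\<lambda>_. carrier R"]) auto
  next
    case (step K g n)
    obtain F where F: "F 0 = K <+>\<^bsub>R\<^esub> PIdl g" "F n = carrier R" "\<forall>i\<le>n. ideal (F i) R"
        "\<forall>i<n. \<exists>g\<in>carrier R. F (Suc i) = F i <+>\<^bsub>R\<^esub> PIdl g \<and> (\<forall>a\<in>I. a \<otimes> g \<in> F i)"
      using step.IH[OF ideal_add_principal(1)[OF step.hyps(1,2)]] by blast
    let ?F = "case_nat K F"
    have "ideal (?F i) R" if "i \<le> Suc n" for i
      using that F(3) step.hyps(1) by (cases i) auto
    moreover have "\<exists>g\<in>carrier R. ?F (Suc i) = ?F i <+>\<^bsub>R\<^esub> PIdl g \<and> (\<forall>a\<in>I. a \<otimes> g \<in> ?F i)"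
      if "i < Suc n" for i
    proof (cases i)
      case 0
      then show ?thesis using step.hyps(2,3) F(1) by auto
    next
      case (Suc j)
      then show ?thesis using F(4) that by simp
    qed
    ultimately show ?case using F(2) by (intro exI[of _ ?F]) simp
  qed
  then show thesis using that by blast
qed

end

section \<open>Cyclic filtrations of quotient modules\<close>

context module
begin

lemma quotient_module_carrier:
  "carrier (quotient_module R M N) = (\<lambda>x. N +>\<^bsub>M\<^esub> x) ` carrier M"
  by (auto simp: quotient_module_def A_RCOSETS_def')

text \<open>The image of a coset under multiplication by a may be smaller than a coset, for instance
  when a = 0. Adding N to it, as \<open>quotient_module\<close> does, restores the full coset of the
  product.\<close>

lemma quotient_module_smult:
  assumes N: "submodule N R M" and a: "a \<in> carrier R" and x: "x \<in> carrier M"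
  shows "a \<odot>\<^bsub>quotient_module R M N\<^esub> (N +>\<^bsub>M\<^esub> x) = N +>\<^bsub>M\<^esub> (a \<odot>\<^bsub>M\<^esub> x)"
proof -
  note NM = subsetD[OF submoduleE(1)[OF N]]
  have zero: "\<zero>\<^bsub>M\<^esub> \<in> N" using subgroup.one_closed[OF submodule.axioms(1)[OF N]] by simp
  have "N <+>\<^bsub>M\<^esub> (\<lambda>m. a \<odot>\<^bsub>M\<^esub> m) ` (N +>\<^bsub>M\<^esub> x) = N +>\<^bsub>M\<^esub> (a \<odot>\<^bsub>M\<^esub> x)"
  proof (intro equalityI subsetI)
    fix z assume "z \<in> N <+>\<^bsub>M\<^esub> (\<lambda>m. a \<odot>\<^bsub>M\<^esub> m) ` (N +>\<^bsub>M\<^esub> x)"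
    then obtain n n' where n: "n \<in> N" "n' \<in> N" and "z = n \<oplus>\<^bsub>M\<^esub> a \<odot>\<^bsub>M\<^esub> (n' \<oplus>\<^bsub>M\<^esub> x)"
      by (auto simp: set_add_def' a_r_coset_def')
    then have "z = (n \<oplus>\<^bsub>M\<^esub> a \<odot>\<^bsub>M\<^esub> n') \<oplus>\<^bsub>M\<^esub> a \<odot>\<^bsub>M\<^esub> x"
      using a x NM by (simp add: smult_r_distr M.a_assoc)
    moreover have "n \<oplus>\<^bsub>M\<^esub> a \<odot>\<^bsub>M\<^esub> n' \<in> N" using n a submoduleE(4,5)[OF N] by simp
    ultimately show "z \<in> N +>\<^bsub>M\<^esub> (a \<odot>\<^bsub>M\<^esub> x)" unfolding a_r_coset_def' by blast
  next
    fix z assume "z \<in> N +>\<^bsub>M\<^esub> (a \<odot>\<^bsub>M\<^esub> x)"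
    moreover have "x \<in> N +>\<^bsub>M\<^esub> x" using zero x by (force simp: a_r_coset_def')
    ultimately show "z \<in> N <+>\<^bsub>M\<^esub> (\<lambda>m. a \<odot>\<^bsub>M\<^esub> m) ` (N +>\<^bsub>M\<^esub> x)"
      by (auto simp: set_add_def' a_r_coset_def'[of _ _ "a \<odot>\<^bsub>M\<^esub> x"])
  qed
  then show ?thesis by (simp add: quotient_module_def)
qed

lemma quotient_module_add:
  assumes N: "submodule N R M" and "x \<in> carrier M" "y \<in> carrier M"
  shows "(N +>\<^bsub>M\<^esub> x) \<oplus>\<^bsub>quotient_module R M N\<^esub> (N +>\<^bsub>M\<^esub> y) = N +>\<^bsub>M\<^esub> (x \<oplus>\<^bsub>M\<^esub> y)"
proof -
  interpret abelian_subgroup N M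
    using submodule.axioms(1)[OF N]
    by (intro abelian_subgroupI3 additive_subgroup.intro M.abelian_group_axioms)
  show ?thesis using assms by (simp add: quotient_module_def a_rcos_sum)
qed

lemma cyclic_quotient_module:
  assumes N: "submodule N R M" and g: "g \<in> carrier M"
    and gen: "\<And>m. m \<in> carrier M \<Longrightarrow> \<exists>n\<in>N. \<exists>a\<in>carrier R. m = n \<oplus>\<^bsub>M\<^esub> a \<odot>\<^bsub>M\<^esub> g"
  shows "cyclic_module R (quotient_module R M N)"
proof -
  have coset: "\<exists>a\<in>carrier R. N +>\<^bsub>M\<^esub> m = N +>\<^bsub>M\<^esub> (a \<odot>\<^bsub>M\<^esub> g)" if m: "m \<in> carrier M" for m
  proof -
    obtain n a where na: "n \<in> N" "a \<in> carrier R" "m = n \<oplus>\<^bsub>M\<^esub> a \<odot>\<^bsub>M\<^esub> g" using gen[OF m] by blast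
    then have "m \<in> N +>\<^bsub>M\<^esub> (a \<odot>\<^bsub>M\<^esub> g)" by (auto simp: a_r_coset_def')
    then have "N +>\<^bsub>M\<^esub> (a \<odot>\<^bsub>M\<^esub> g) = N +>\<^bsub>M\<^esub> m"
      using na g by (intro M.a_repr_independence submodule.axioms(1)[OF N]) auto
    with na show ?thesis by metis
  qed
  have "(\<lambda>m. N +>\<^bsub>M\<^esub> m) ` carrier M = (\<lambda>a. N +>\<^bsub>M\<^esub> (a \<odot>\<^bsub>M\<^esub> g)) ` carrier R"
    using coset g by (intro equalityI image_subsetI) blast+
  also have "\<dots> = {a \<odot>\<^bsub>quotient_module R M N\<^esub> (N +>\<^bsub>M\<^esub> g) | a. a \<in> carrier R}"
    using quotient_module_smult[OF N _ g] by auto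
  finally show ?thesis
    unfolding cyclic_module_def quotient_module_carrier using g by blast
qed

lemma killed_by_quotient_module:
  assumes N: "submodule N R M" and "I \<subseteq> carrier R"
    and "\<And>a m. a \<in> I \<Longrightarrow> m \<in> carrier M \<Longrightarrow> a \<odot>\<^bsub>M\<^esub> m \<in> N"
  shows "killed_by I (quotient_module R M N)"
proof -
  have "N +>\<^bsub>M\<^esub> (a \<odot>\<^bsub>M\<^esub> m) = N" if "a \<in> I" "m \<in> carrier M" for a m
    using that assms by (intro M.a_coset_join2 submodule.axioms(1)[OF N]) auto
  moreover have "\<zero>\<^bsub>quotient_module R M N\<^esub> = N" by (simp add: quotient_module_def)
  ultimately show ?thesis
    unfolding killed_by_def quotient_module_carrier
    using assms(2) by (auto simp: quotient_module_smult[OF N])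
qed

end

section \<open>Quasilength of quotients of the regular module\<close>

context cring
begin

lemma submodule_regular_module_iff: "submodule N R (regular_module R) \<longleftrightarrow> ideal N R"
proof -
  \<comment> \<open>Both additive monoids have the same carrier, addition and zero, and subgroups
    and inverses depend on nothing else.\<close>
  have *: "subgroup N (add_monoid (regular_module R)) \<longleftrightarrow> subgroup N (add_monoid R)" for N
    by (simp add: subgroup_def m_inv_def regular_module_def)
  show ?thesis
  proof
    assume "submodule N R (regular_module R)"
    then interpret submodule N R "regular_module R" .
    have sub: "N \<subseteq> carrier R" using subset by (simp add: regular_module_def)
    have "a \<otimes> x \<in> N" if "a \<in> carrier R" "x \<in> N" for a x
      using smult_closed[OF that] by (simp add: regular_module_def)
    moreover from this have "x \<otimes> a \<in> N" if "a \<in> carrier R" "x \<in> N" for a x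
      using that sub by (metis m_comm subsetD)
    ultimately show "ideal N R"
      using subgroup_axioms * by (intro idealI[OF ring_axioms]) auto
  next
    assume N: "ideal N R"
    then have "subgroup N (add_monoid (regular_module R))"
      by (simp add: * additive_subgroup.a_subgroup ideal.axioms(1))
    moreover have "submodule_axioms N R (regular_module R)"
      using ideal.I_l_closed[OF N] by (intro submodule_axioms.intro) (simp add: regular_module_def)
    ultimately show "submodule N R (regular_module R)" by (rule submodule.intro)
  qed
qed

text \<open>J absorbs all products, and any submodule containing the products a m with a \<in> J
  contains a = a 1.\<close>

lemma ideal_smult_regular_module:
  assumes J: "ideal J R"
  shows "ideal_smult R J (regular_module R) = J"
proof -
  have "J \<subseteq> N" if "\<forall>a\<in>J. \<forall>m\<in>carrier R. a \<otimes> m \<in> N" for N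
    using that ideal.Icarr[OF J] by (metis one_closed r_one subsetI)
  moreover have "\<forall>a\<in>J. \<forall>m\<in>carrier R. a \<otimes> m \<in> J"
    using ideal.I_r_closed[OF J] by blast
  ultimately have "\<Inter>{N. ideal N R \<and> (\<forall>a\<in>J. \<forall>m\<in>carrier R. a \<otimes> m \<in> N)} = J"
    using J by (intro equalityI Inter_lower Inter_greatest) blast+
  then show ?thesis
    unfolding ideal_smult_def submodule_regular_module_iff by (simp add: regular_module_def)
qed

text \<open>The images F_i/K of the ideals of the chain filter R/K. The factor (F_(i+1)/K)/(F_i/K)
  is generated by the class of g, and I kills it because Ig lies in F_i.\<close>

lemma quasilength_le_cyclic_chain:
  assumes chain: "cyclic_chain I K n" and K: "ideal K R" and I: "I \<subseteq> carrier R"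
  shows "quasilength R I (quotient_module R (regular_module R) K) \<le> enat n"
proof -
  let ?M = "regular_module R"
  let ?Q = "quotient_module R ?M K"
  let ?pi = "\<lambda>r. K +>\<^bsub>?M\<^esub> r"
  obtain F where F: "F 0 = K" "F n = carrier R" "\<And>i. i \<le> n \<Longrightarrow> ideal (F i) R"
    and step: "\<And>i. i < n \<Longrightarrow>
      \<exists>g\<in>carrier R. F (Suc i) = F i <+>\<^bsub>R\<^esub> PIdl g \<and> (\<forall>a\<in>I. a \<otimes> g \<in> F i)"
    using cyclic_chain_filtration[OF chain K] by blast
  interpret M: module R ?M by (rule regular_module)
  have KM: "submodule K R ?M" using K by (simp add: submodule_regular_module_iff)
  interpret Q: module R ?Q by (rule M.quotient_module[OF KM])
  have carrM: "carrier ?M = carrier R" by (simp add: regular_module_def)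
  have carrQ: "carrier ?Q = ?pi ` carrier R" by (simp add: M.quotient_module_carrier carrM)
  have pi_smult: "a \<odot>\<^bsub>?Q\<^esub> ?pi r = ?pi (a \<otimes> r)" if "a \<in> carrier R" "r \<in> carrier R" for a r
    using M.quotient_module_smult[OF KM] that by (simp add: regular_module_def)
  have pi_add: "?pi r \<oplus>\<^bsub>?Q\<^esub> ?pi s = ?pi (r \<oplus> s)" if "r \<in> carrier R" "s \<in> carrier R" for r s
    using M.quotient_module_add[OF KM] that by (simp add: regular_module_def)
  have pi_K: "?pi r = \<zero>\<^bsub>?Q\<^esub>" if "r \<in> K" for r
    using M.a_coset_join2[OF _ submodule.axioms(1)[OF KM] that] ideal.Icarr[OF K that]
    by (simp add: quotient_module_def carrM)
  have zeroF: "\<zero> \<in> F i" if "i \<le> n" for i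
    using F(3)[OF that] by (simp add: additive_subgroup.zero_closed ideal_def)
  have subF: "F i \<subseteq> carrier R" if "i \<le> n" for i
    using F(3)[OF that] by (simp add: additive_subgroup.a_subset ideal_def)
  have pi_uminus: "\<ominus>\<^bsub>?Q\<^esub> ?pi r = ?pi (\<ominus> r)" if "r \<in> carrier R" for r
    using Q.smult_l_minus[of \<one> "?pi r"] that carrQ by (simp add: pi_smult l_minus)
  define G where "G i = ?pi ` F i" for i
  have G: "submodule (G i) R ?Q" if "i \<le> n" for i
  proof -
    interpret Fi: ideal "F i" R by (rule F(3)[OF that])
    have "\<zero>\<^bsub>?Q\<^esub> = ?pi \<zero>" using pi_K zeroF[of 0] F(1) by simp
    then have "\<zero>\<^bsub>?Q\<^esub> \<in> G i" using zeroF[OF that] by (simp add: G_def)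
    moreover have "\<ominus>\<^bsub>?Q\<^esub> c \<in> G i" if c: "c \<in> G i" for c
    proof -
      obtain r where "r \<in> F i" "c = ?pi r" using c by (auto simp: G_def)
      then show ?thesis using Fi.Icarr Fi.a_inv_closed by (simp add: G_def pi_uminus)
    qed
    moreover have "c \<oplus>\<^bsub>?Q\<^esub> d \<in> G i" if "c \<in> G i" "d \<in> G i" for c d
    proof -
      obtain r s where "r \<in> F i" "c = ?pi r" "s \<in> F i" "d = ?pi s"
        using \<open>c \<in> G i\<close> \<open>d \<in> G i\<close> unfolding G_def by blast
      then show ?thesis using Fi.Icarr by (simp add: G_def pi_add)
    qed
    moreover have "a \<odot>\<^bsub>?Q\<^esub> c \<in> G i" if a: "a \<in> carrier R" and c: "c \<in> G i" for a c
    proof -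
      obtain r where "r \<in> F i" "c = ?pi r" using c by (auto simp: G_def)
      then show ?thesis using a Fi.Icarr Fi.I_l_closed by (simp add: G_def pi_smult)
    qed
    moreover have "G i \<subseteq> carrier ?Q"
      unfolding G_def carrQ using subF[OF that] by (rule image_mono)
    ultimately show ?thesis by (intro Q.submoduleI)
  qed
  have quot: "cyclic_module R (quotient_module R (?Q\<lparr>carrier := G (Suc i)\<rparr>) (G i))"
      "killed_by I (quotient_module R (?Q\<lparr>carrier := G (Suc i)\<rparr>) (G i))"
      "G i \<subseteq> G (Suc i)" if i: "i < n" for i
  proof -
    have i': "i \<le> n" "Suc i \<le> n" using i by auto
    obtain g where g: "g \<in> carrier R" "F (Suc i) = F i <+>\<^bsub>R\<^esub> PIdl g" "\<forall>a\<in>I. a \<otimes> g \<in> F i"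
      using step[OF i] by blast
    have FSuc: "F i \<subseteq> F (Suc i)" "g \<in> F (Suc i)"
      using ideal_add_principal[OF F(3)[OF i'(1)] g(1)] g(2) by auto
    then show sub: "G i \<subseteq> G (Suc i)" by (auto simp: G_def)
    interpret Fi: ideal "F i" R by (rule F(3)[OF i'(1)])
    let ?M' = "?Q\<lparr>carrier := G (Suc i)\<rparr>"
    interpret M': module R ?M'
      by (rule submodule.submodule_is_module[OF G[OF i'(2)] Q.module_axioms])
    \<comment> \<open>\<open>G i\<close> is known as a submodule of R/K; with the same operations it
      is one of the smaller module \<open>G (Suc i)\<close>.\<close>
    have N: "submodule (G i) R ?M'"
      using submodule.submodule_is_module[OF G[OF i'(1)] Q.module_axioms] sub
      by (intro M'.module_incl_imp_submodule) auto
    have decomp: "\<exists>k\<in>F i. \<exists>a\<in>carrier R. m = ?pi (k \<oplus> a \<otimes> g)" if m: "m \<in> carrier ?M'" for m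
    proof -
      obtain r where r: "r \<in> F i <+>\<^bsub>R\<^esub> PIdl g" "m = ?pi r"
        using m unfolding G_def g(2) by auto
      then obtain k z where "k \<in> F i" "z \<in> PIdl g" "r = k \<oplus> z" unfolding set_add_def' by blast
      then show ?thesis using r(2) unfolding cgenideal_def by blast
    qed
    show "cyclic_module R (quotient_module R ?M' (G i))"
    proof (rule M'.cyclic_quotient_module[OF N])
      show "?pi g \<in> carrier ?M'" using FSuc by (simp add: G_def)
      fix m assume "m \<in> carrier ?M'"
      then obtain k a where "k \<in> F i" "a \<in> carrier R" "m = ?pi (k \<oplus> a \<otimes> g)"
        using decomp by blast
      then show "\<exists>n\<in>G i. \<exists>a\<in>carrier R. m = n \<oplus>\<^bsub>?M'\<^esub> a \<odot>\<^bsub>?M'\<^esub> ?pi g"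
        using g Fi.Icarr by (intro bexI[of _ "?pi k"] bexI[of _ a]) (simp_all add: G_def pi_smult pi_add)
    qed
    show "killed_by I (quotient_module R ?M' (G i))"
    proof (rule M'.killed_by_quotient_module[OF N I])
      fix a m assume a: "a \<in> I" and m: "m \<in> carrier ?M'"
      obtain k b where kb: "k \<in> F i" "b \<in> carrier R" "m = ?pi (k \<oplus> b \<otimes> g)"
        using decomp[OF m] by blast
      have carr: "a \<in> carrier R" "k \<in> carrier R" using a I kb Fi.Icarr by auto
      \<comment> \<open>In the rearranged sum, a k lies in F_i because k does, and b(a g) because a
        g does.\<close>
      have "a \<otimes> (k \<oplus> b \<otimes> g) = a \<otimes> k \<oplus> b \<otimes> (a \<otimes> g)"
        using carr kb g by (simp add: r_distr m_ac)
      also have "\<dots> \<in> F i"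
        using carr kb g a by (simp add: Fi.I_l_closed)
      finally show "a \<odot>\<^bsub>?M'\<^esub> m \<in> G i"
        using carr kb g by (simp add: G_def pi_smult)
    qed
  qed
  have "G 0 = {\<zero>\<^bsub>?Q\<^esub>}"
    using pi_K zeroF[of 0] F(1) by (force simp: G_def)
  moreover have "G n = carrier ?Q" by (simp add: G_def F(2) carrQ)
  ultimately have "cyclic_filtration R I ?Q n G"
    unfolding cyclic_filtration_def using G quot by simp
  then show ?thesis unfolding quasilength_def by (intro INF_lower) blast
qed

section \<open>Power ideals and their limit closures\<close>

lemma power_ideal:
  assumes "set xs \<subseteq> carrier R"
  shows "ideal (power_ideal R xs t) R"
    "j < length xs \<Longrightarrow> (xs ! j) [^] (t ! j) \<in> power_ideal R xs t"
proof -
  have sub: "{(xs ! j) [^] (t ! j) | j. j < length xs} \<subseteq> carrier R"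
    using assms by (auto intro!: nat_pow_closed)
  show "ideal (power_ideal R xs t) R"
    unfolding power_ideal_def by (rule genideal_ideal[OF sub])
  show "(xs ! j) [^] (t ! j) \<in> power_ideal R xs t" if "j < length xs"
    unfolding power_ideal_def using genideal_self[OF sub] that by blast
qed

text \<open>Multiplying the generator x_j^(t_j + k) by x_1 ... x_d raises its exponent by one and
  leaves the product of the other x_i as a cofactor. Generators suffice, because the colon set is an
  ideal.\<close>

lemma power_ideal_mult_prod:
  assumes xs: "set xs \<subseteq> carrier R" and len: "length t = length xs"
    and r: "r \<in> power_ideal R xs (map (\<lambda>n. n + k) t)"
  shows "r \<otimes> (\<Otimes>j\<in>{..<length xs}. xs ! j) \<in> power_ideal R xs (map (\<lambda>n. n + Suc k) t)"
proof -
  let ?p = "\<Otimes>j\<in>{..<length xs}. xs ! j"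
  let ?J = "power_ideal R xs (map (\<lambda>n. n + Suc k) t)"
  have x: "xs ! j \<in> carrier R" if "j < length xs" for j using that xs by auto
  have p: "?p \<in> carrier R" using x by (intro finprod_closed) auto
  note J = power_ideal[OF xs, where t = "map (\<lambda>n. n + Suc k) t"]
  have gen: "(xs ! j) [^] (map (\<lambda>n. n + k) t ! j) \<otimes> ?p \<in> ?J" if j: "j < length xs" for j
  proof -
    let ?q = "\<Otimes>i\<in>{..<length xs} - {j}. xs ! i"
    have "finprod R (\<lambda>i. xs ! i) (insert j ({..<length xs} - {j})) = xs ! j \<otimes> ?q"
      using x j by (intro finprod_insert) auto
    moreover have "insert j ({..<length xs} - {j}) = {..<length xs}" using j by auto
    ultimately have pq: "?p = xs ! j \<otimes> ?q" by simp
    have q: "?q \<in> carrier R" using x by (intro finprod_closed) auto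
    have "(xs ! j) [^] (map (\<lambda>n. n + k) t ! j) \<otimes> ?p
        = (xs ! j) [^] (map (\<lambda>n. n + Suc k) t ! j) \<otimes> ?q"
      using j len x[OF j] q by (simp add: pq m_assoc)
    also have "\<dots> \<in> ?J" by (rule ideal.I_r_closed[OF J(1) J(2)[OF j] q])
    finally show ?thesis .
  qed
  have "power_ideal R xs (map (\<lambda>n. n + k) t) \<subseteq> {r \<in> carrier R. r \<otimes> ?p \<in> ?J}"
    unfolding power_ideal_def[of _ _ "map (\<lambda>n. n + k) t"]
  proof (intro genideal_minimal ideal_colon J(1) p subsetI)
    fix z assume "z \<in> {(xs ! j) [^] (map (\<lambda>n. n + k) t ! j) | j. j < length xs}"
    then show "z \<in> {r \<in> carrier R. r \<otimes> ?p \<in> ?J}"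
      using gen x by auto
  qed
  then show ?thesis using r by blast
qed

text \<open>With p = x_1 ... x_d, the ideals (I_(t+k) : p^k) ascend in k, as multiplication by p
  maps I_(t+k) into I_(t+k+1). Hence their union is an ideal, and its term k = 0 is I_t.\<close>

lemma limit_closure_regular_module:
  assumes xs: "set xs \<subseteq> carrier R" and len: "length t = length xs"
  shows "ideal (limit_closure R (regular_module R) xs t) R"
    "power_ideal R xs t \<subseteq> limit_closure R (regular_module R) xs t"
proof -
  define p where "p = (\<Otimes>j\<in>{..<length xs}. xs ! j)"
  have p: "p \<in> carrier R" unfolding p_def using xs by (intro finprod_closed) auto
  define J where "J k = power_ideal R xs (map (\<lambda>n. n + k) t)" for k
  have J: "ideal (J k) R" for k unfolding J_def by (rule power_ideal(1)[OF xs])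
  define S where "S k = {m \<in> carrier R. m \<otimes> p [^] k \<in> J k}" for k :: nat
  have S: "ideal (S k) R" for k unfolding S_def using p by (intro ideal_colon J) simp
  have lc: "limit_closure R (regular_module R) xs t = (\<Union>k. S k)"
    unfolding limit_closure_def submodule_colon_def ideal_smult_regular_module[OF power_ideal(1)[OF xs]]
      S_def J_def p_def[symmetric]
    using p by (intro SUP_cong Collect_cong) (auto simp: regular_module_def m_comm)
  have "S k \<subseteq> S (Suc k)" for k
  proof
    fix m assume "m \<in> S k"
    then have m: "m \<in> carrier R" "m \<otimes> p [^] k \<in> J k" by (auto simp: S_def)
    then have "m \<otimes> p [^] k \<otimes> p \<in> J (Suc k)"
      using power_ideal_mult_prod[OF xs len] unfolding J_def p_def by blast
    then show "m \<in> S (Suc k)" using m p by (simp add: S_def m_assoc)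
  qed
  then have mono: "S i \<subseteq> S j" if "i \<le> j" for i j
    using that lift_Suc_mono_le[of S] by blast
  have "S i \<subseteq> S j \<or> S j \<subseteq> S i" for i j
    using mono[of i j] mono[of j i] by (cases "i \<le> j") simp_all
  then have "subset.chain {I. ideal I R} (range S)"
    using S by (simp add: subset_chain_def image_subset_iff)
  then show "ideal (limit_closure R (regular_module R) xs t) R"
    using chain_Union_is_ideal[of "range S"] by (simp add: lc)
  have "power_ideal R xs t \<subseteq> S 0"
    using ideal.Icarr[OF J[of 0]] by (auto simp: S_def J_def)
  then show "power_ideal R xs t \<subseteq> limit_closure R (regular_module R) xs t"
    unfolding lc by blast
qed

end

section \<open>Vanishing of the content\<close>

text \<open>Each infimum is already 0: the diagonal exponents (N, N, N) with N > s give a quotient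
  of at most c N^2 / N^3 = c / N, and N is arbitrarily large.\<close>

lemma lim_INF_exponents_eq_0:
  fixes L :: "nat list \<Rightarrow> enat"
  assumes L: "\<And>N. 0 < N \<Longrightarrow> L [N, N, N] \<le> enat (c * N\<^sup>2)"
  shows "lim (\<lambda>s. INF t\<in>exponents_ge 3 s. ennreal_of_enat (L t) / of_nat (prod_list t)) = 0"
proof -
  have "(INF t\<in>exponents_ge 3 s. ennreal_of_enat (L t) / of_nat (prod_list t)) = 0" (is "?inf = 0") for s
  proof -
    \<comment> \<open>The bound \<open>Suc s\<close> keeps N positive also for s = 0.\<close>
    have bound: "?inf \<le> ennreal (real c / real N)" if N: "N \<ge> Suc s" for N
    proof -
      have "?inf \<le> ennreal_of_enat (L [N, N, N]) / of_nat (prod_list [N, N, N])"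
        using N by (intro INF_lower) (auto simp: exponents_ge_def)
      also have "\<dots> \<le> ennreal_of_enat (enat (c * N\<^sup>2)) / of_nat (prod_list [N, N, N])"
        using N by (intro divide_right_mono_ennreal iffD2[OF ennreal_of_enat_le_iff] L) simp
      also have "\<dots> = ennreal (real (c * N\<^sup>2) / real (N * (N * N)))"
        using N by (simp add: ennreal_of_nat_eq_real_of_nat divide_ennreal del: of_nat_mult of_nat_power)
      also have "real (c * N\<^sup>2) / real (N * (N * N)) = real c / real N"
        using N by (simp add: power2_eq_square)
      finally show ?thesis .
    qed
    have "(\<lambda>N. real c / real N) \<longlonglongrightarrow> 0" by (rule lim_const_over_n)
    then have "(\<lambda>N. ennreal (real c / real N)) \<longlonglongrightarrow> ennreal 0" by (rule tendsto_ennrealI)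
    then have "?inf \<le> ennreal 0" using bound by (intro LIMSEQ_le_const) auto
    then show ?thesis by simp
  qed
  then show ?thesis by (simp add: limI)
qed

section \<open>The polynomial ring and the vanishing of both contents\<close>

lemma cring_poly4:
  assumes "cring A"
  shows "cring (poly4 A)"
  using assms unfolding poly4_def by (intro UP_cring.UP_cring UP_cring.intro)

lemma poly4_vars_closed:
  assumes "cring A"
  shows "poly4_x A \<in> carrier (poly4 A)" "poly4_y A \<in> carrier (poly4 A)"
    "poly4_u A \<in> carrier (poly4 A)" "poly4_v A \<in> carrier (poly4 A)"
proof -
  \<comment> \<open>The type of \<open>S\<close> is left general, so that these facts apply at every
    stage of the tower of polynomial rings.\<close>
  have UP: "cring (UP S)" if "cring S" for S :: "('c, 'd) ring_scheme"
    using that by (intro UP_cring.UP_cring UP_cring.intro)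
  have mon: "monom (UP S) c n \<in> carrier (UP S)" if "cring S" "c \<in> carrier S" for S :: "('c, 'd) ring_scheme" and c n
    using that by (intro UP_ring.monom_closed UP_ring.intro cring.axioms(1))
  have one: "\<one>\<^bsub>S\<^esub> \<in> carrier S" if "cring S" for S :: "('c, 'd) ring_scheme"
    using that by (simp add: cring_def ring.ring_simprules)
  note S1 = UP[OF assms] note S2 = UP[OF S1] note S3 = UP[OF S2]
  note S = assms S1 S2 S3
  show "poly4_x A \<in> carrier (poly4 A)" "poly4_y A \<in> carrier (poly4 A)"
    "poly4_u A \<in> carrier (poly4 A)" "poly4_v A \<in> carrier (poly4 A)"
    unfolding poly4_def poly4_x_def poly4_y_def poly4_u_def poly4_v_def
    by (simp_all only: mon one S)
qed

text \<open>For t = (N, N, N) both I_t and its limit closure are ideals containing the N-th powers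
  of the three elements, so the single bound 8 N^2 settles both contents with c = 8.\<close>

lemma (in cring) segre_content:
  assumes carr: "x \<in> carrier R" "y \<in> carrier R" "u \<in> carrier R" "v \<in> carrier R"
  defines "xs \<equiv> [x \<otimes> u, y \<otimes> v, x \<otimes> v \<oplus> y \<otimes> u]"
  shows "module_content R xs (regular_module R) = 0"
    "lower_module_content R xs (regular_module R) = 0"
proof -
  have xs: "set xs \<subseteq> carrier R" and len: "length xs = 3" using carr by (auto simp: xs_def)
  have quasi: "quasilength R (genideal R (set xs)) (quotient_module R (regular_module R) K) \<le> enat (8 * N\<^sup>2)"
    if K: "ideal K R" "power_ideal R xs [N, N, N] \<subseteq> K" for K N
  proof -
    have pow: "(xs ! j) [^] ([N, N, N] ! j) \<in> K" if "j < 3" for j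
      using power_ideal(2)[OF xs] K(2) that len by auto
    have "cyclic_chain (Idl (set xs)) K (8 * N\<^sup>2)"
      using cyclic_chain_segre[OF carr K(1), of N] pow[of 0] pow[of 1] pow[of 2] by (simp add: xs_def)
    moreover have "Idl (set xs) \<subseteq> carrier R"
      by (rule additive_subgroup.a_subset[OF ideal.axioms(1)[OF genideal_ideal[OF xs]]])
    ultimately show ?thesis using K(1) by (intro quasilength_le_cyclic_chain)
  qed
  show "module_content R xs (regular_module R) = 0"
    unfolding module_content_def len
    by (intro lim_INF_exponents_eq_0[where c = 8] quasi)
      (simp_all add: ideal_smult_regular_module power_ideal(1)[OF xs])
  show "lower_module_content R xs (regular_module R) = 0"
    unfolding lower_module_content_def len
    by (intro lim_INF_exponents_eq_0[where c = 8] quasi limit_closure_regular_module xs) (simp_all add: len)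
qed

theorem theorem4p3:
  fixes A :: "('a, 'm) ring_scheme"
  assumes "cring A" and "noetherian_ring A"
    and R: "R = poly4 A"
    and x: "x = poly4_x A" and y: "y = poly4_y A" and u: "u = poly4_u A" and v: "v = poly4_v A"
    and x1: "x1 = x \<otimes>\<^bsub>R\<^esub> u"
    and x2: "x2 = y \<otimes>\<^bsub>R\<^esub> v"
    and x3: "x3 = (x \<otimes>\<^bsub>R\<^esub> v) \<oplus>\<^bsub>R\<^esub> (y \<otimes>\<^bsub>R\<^esub> u)"
  shows "module_content R [x1, x2, x3] (regular_module R) = 0
    \<and> lower_module_content R [x1, x2, x3] (regular_module R) = 0"
  unfolding x1 x2 x3 R x y u v
  using cring.segre_content[OF cring_poly4[OF assms(1)] poly4_vars_closed[OF assms(1)]] by simp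

end
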